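(* Let $(X,d)$ be a complete dislocated metric space and let $T:X\to X$ be a self-mapping. Suppose that there exist $\alpha\in\mathcal{A}_d$ and $\phi\in\Phi$ such that $\Psi(s)=\int_0^s\phi(t)\,dt$ is subadditive on $[0,\infty)$ and \[ \int_0^{d(Tx,Ty)}\phi(t)\,dt\le\alpha\left(\int_0^{d(x,y)}\phi(t)\,dt,\ \int_0^{d(x,Tx)}\phi(t)\,dt,\ \int_0^{d(y,Ty)}\phi(t)\,dt\right) \] for all $x,y\in X$. Then $T$ has a unique fixed point $z\in X$, and $d(z,z)=0$.
   Context: Write $\mathbb{R}_+=[0,\infty)$. A dislocated metric on a non-empty set $X$ is a function $d:X\times X\to\mathbb{R}_+$ such that for all $x,y,z\in X$: (i) $d(x,y)=d(y,x)$; (ii) $d(x,y)=0$ implies $x=y$; (iii) $d(x,y)\le d(x,z)+d(z,y)$. (The self-distance $d(x,x)$ is not required to be zero.) Then $(X,d)$ is called a dislocated metric space. A sequence $\{x_n\}$ in $X$ is $d$-Cauchy if for every $\varepsilon>0$ there is $n_0\in\mathbb{N}$ with $d(x_m,x_n)<\varepsilon$ for all $m,n\ge n_0$ (including $m=n$). A sequence $\{x_n\}$ converges to $x\in X$ with respect to $d$ if $\lim_{n\to\infty}d(x_n,x)=0$. $(X,d)$ is complete if every $d$-Cauchy sequence converges with respect to $d$ to some point of $X$. The class $\mathcal{A}_d$ consists of all functions $\alpha:\mathbb{R}_+^3\to\mathbb{R}_+$ such that: (A1) $\alpha$ is continuous on $\mathbb{R}_+^3$; (A2) there exists a constant $k_\alpha\in[0,1)$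 such that, for all $a,b\in\mathbb{R}_+$, whenever $a\le\alpha(a,b,b)$ or $a\le\alpha(b,a,b)$ or $a\le\alpha(b,b,a)$, then $a\le k_\alpha b$. The class $\Phi$ consists of all functions $\phi:[0,\infty)\to[0,\infty)$ which are Lebesgue integrable, summable (i.e. with finite integral) on each compact subset of $[0,\infty)$, non-negative, and satisfy $\int_0^\varepsilon\phi(t)\,dt>0$ for every $\varepsilon>0$. A function $\Psi:[0,\infty)\to[0,\infty)$ is subadditive if $\Psi(s+t)\le\Psi(s)+\Psi(t)$ for all $s,t\ge 0$. *)

theory Defs
  imports "HOL-Analysis.Analysis"
begin

locale dislocated_metric_space =
  fixes X :: "'a set" and d :: "'a \<Rightarrow> 'a \<Rightarrow> real"
  assumes nonempty: "X \<noteq> {}"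
    and nonneg: "\<lbrakk>x \<in> X; y \<in> X\<rbrakk> \<Longrightarrow> 0 \<le> d x y"
    and sym: "\<lbrakk>x \<in> X; y \<in> X\<rbrakk> \<Longrightarrow> d x y = d y x"
    and eq_if_zero: "\<lbrakk>x \<in> X; y \<in> X; d x y = 0\<rbrakk> \<Longrightarrow> x = y"
    and triangle: "\<lbrakk>x \<in> X; y \<in> X; z \<in> X\<rbrakk> \<Longrightarrow> d x y \<le> d x z + d z y"
begin

definition d_Cauchy :: "(nat \<Rightarrow> 'a) \<Rightarrow> bool" where
  "d_Cauchy x \<longleftrightarrow> range x \<subseteq> X \<and> (\<forall>\<epsilon>>0. \<exists>n0. \<forall>m\<ge>n0. \<forall>n\<ge>n0. d (x m) (x n) < \<epsilon>)"

definition d_converges :: "(nat \<Rightarrow> 'a) \<Rightarrow> 'a \<Rightarrow> bool" where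
  "d_converges x z \<longleftrightarrow> range x \<subseteq> X \<and> z \<in> X \<and> (\<lambda>n. d (x n) z) \<longlonglongrightarrow> 0"

definition d_complete :: bool where
  "d_complete \<longleftrightarrow> (\<forall>x. d_Cauchy x \<longrightarrow> (\<exists>z\<in>X. d_converges x z))"

end

locale complete_dislocated_metric_space = dislocated_metric_space X d
  for X :: "'a set" and d :: "'a \<Rightarrow> 'a \<Rightarrow> real" +
  assumes complete: "d_complete"

text \<open>
  Functions on \<open>[0, \<infinity>)\<close> and on its third power are represented by total functions on the reals
  that are constrained only for non-negative arguments.
\<close>

definition class_A_d :: "(real \<Rightarrow> real \<Rightarrow> real \<Rightarrow> real) set" where
  "class_A_d = {\<alpha>.
     (\<forall>a\<ge>0. \<forall>b\<ge>0. \<forall>c\<ge>0. 0 \<le> \<alpha> a b c) \<and>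
     continuous_on ({0..} \<times> {0..} \<times> {0..}) (\<lambda>(a, b, c). \<alpha> a b c) \<and>
     (\<exists>k. 0 \<le> k \<and> k < 1 \<and>
        (\<forall>a\<ge>0. \<forall>b\<ge>0. a \<le> \<alpha> a b b \<or> a \<le> \<alpha> b a b \<or> a \<le> \<alpha> b b a \<longrightarrow> a \<le> k * b))}"

text \<open>
  Integrability is required on compact subsets only, so that for instance a positive constant
  function belongs to the class; on the whole half-line a non-negative function is just asked to
  be Lebesgue measurable, its integral there may be infinite.
\<close>

definition class_Phi :: "(real \<Rightarrow> real) set" where
  "class_Phi = {\<phi>.
     (\<forall>t\<ge>0. 0 \<le> \<phi> t) \<and>
     \<phi> \<in> borel_measurable (lebesgue_on {0..}) \<and>
     (\<forall>K. compact K \<and> K \<subseteq> {0..} \<longrightarrow> set_integrable lebesgue K \<phi>) \<and>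
     (\<forall>\<epsilon>>0. (LINT t:{0..\<epsilon>}|lebesgue. \<phi> t) > 0)}"

definition subadditive_on_nonneg :: "(real \<Rightarrow> real) \<Rightarrow> bool" where
  "subadditive_on_nonneg \<Psi> \<longleftrightarrow> (\<forall>s\<ge>0. \<forall>t\<ge>0. \<Psi> (s + t) \<le> \<Psi> s + \<Psi> t)"

end

theory Submission
  imports Defs
begin

text \<open>
  Since \<open>\<Psi>(s) = \<integral>\<^sub>0\<^sup>s \<phi>\<close> is continuous, monotone, subadditive and vanishes exactly at \<open>0\<close>, the
  composition \<open>\<Psi> \<circ> d\<close> is again a complete dislocated metric, and the integral condition says that
  \<open>T\<close> satisfies the plain condition \<open>d(Tx,Ty) \<le> \<alpha>(d(x,y), d(x,Tx), d(y,Ty))\<close> for it. Under the plain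
  condition, (A2) makes the distances of consecutive Picard iterates decay geometrically, so the
  iterates converge to some \<open>z\<close>. Passing to the limit by (A1) gives
  \<open>d(z,Tz) \<le> \<alpha>(0, 0, d(z,Tz))\<close>, and (A2) with \<open>b = 0\<close> forces \<open>Tz = z\<close>.
\<close>

context dislocated_metric_space
begin

text \<open>The triangle inequality along consecutive terms bounds the distance from
  \<open>x m\<close> to any later term by the geometric tail \<open>B m\<close>, which tends to 0.
  Since \<open>d (x m) (x m)\<close> need not vanish, the diagonal case of \<open>d_Cauchy\<close>
  needs its own bound.\<close>

lemma d_Cauchy_geometric:
  assumes x: "range x \<subseteq> X" and k: "0 \<le> k" "k < 1"
    and decay: "\<And>n. d (x n) (x (Suc n)) \<le> k ^ n * C"
  shows "d_Cauchy x"
proof -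
  have xX: "x n \<in> X" for n using x by auto
  have C: "0 \<le> C" using decay[of 0] nonneg[OF xX xX, of 0 1] by simp
  define B where "B m = k ^ m * C / (1 - k)" for m
  have B_nonneg: "0 \<le> B m" for m using k C by (simp add: B_def)
  have far: "d (x m) (x (m + Suc j)) \<le> (\<Sum>i\<le>j. k ^ (m + i) * C)" for m j
  proof (induction j)
    case 0
    show ?case using decay[of m] by simp
  next
    case (Suc j)
    have "d (x m) (x (m + Suc (Suc j)))
        \<le> d (x m) (x (m + Suc j)) + d (x (m + Suc j)) (x (Suc (m + Suc j)))"
      using triangle[OF xX xX xX] by simp
    also have "\<dots> \<le> (\<Sum>i\<le>j. k ^ (m + i) * C) + k ^ (m + Suc j) * C"
      using Suc decay[of "m + Suc j"] by (intro add_mono) simp_all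
    finally show ?case by simp
  qed
  have geo: "(\<Sum>i\<le>j. k ^ (m + i) * C) \<le> B m" for m j
  proof -
    have "(\<Sum>i\<le>j. k ^ (m + i) * C) = k ^ m * C * (\<Sum>i\<le>j. k ^ i)"
      by (simp add: power_add sum_distrib_left mult_ac)
    also have "\<dots> \<le> k ^ m * C * (1 / (1 - k))"
    proof (rule mult_left_mono)
      show "(\<Sum>i\<le>j. k ^ i) \<le> 1 / (1 - k)"
        using k sum_gp0[of k j] by (simp add: divide_right_mono)
    qed (use k C in simp)
    finally show ?thesis by (simp add: B_def)
  qed
  have far_B: "d (x m) (x (m + Suc j)) \<le> B m" for m j
    using far[of m j] geo[of m j] by (rule order_trans)
  \<comment> \<open>\<open>B m\<close> already bounds this distance; the factor 2 makes the bound
    agree with the one for \<open>m = n\<close>.\<close>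
  have lt: "d (x m) (x n) \<le> 2 * B m" if mn: "m < n" for m n
  proof -
    obtain j where "n = m + Suc j"
      using less_imp_Suc_add[OF mn] by auto
    then show ?thesis using far_B[of m j] B_nonneg[of m] by simp
  qed
  \<comment> \<open>Going from \<open>x m\<close> to \<open>x (Suc m)\<close> and back costs two
    steps, hence the factor 2.\<close>
  have self: "d (x m) (x m) \<le> 2 * B m" for m
  proof -
    have "d (x m) (x m) \<le> d (x m) (x (Suc m)) + d (x (Suc m)) (x m)"
      using triangle[OF xX xX xX] .
    also have "\<dots> = 2 * d (x m) (x (m + Suc 0))" using sym[OF xX xX, of "Suc m" m] by simp
    also have "\<dots> \<le> 2 * B m" using far_B[of m 0] by simp
    finally show ?thesis .
  qed
  have "(\<lambda>m. 2 * (k ^ m * C / (1 - k))) \<longlonglongrightarrow> 2 * (0 * C / (1 - k))"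
    using k by (intro tendsto_intros LIMSEQ_realpow_zero) auto
  then have B0: "(\<lambda>m. 2 * B m) \<longlonglongrightarrow> 0" by (simp add: B_def)
  show ?thesis
    unfolding d_Cauchy_def
  proof (intro conjI x allI impI)
    fix \<epsilon> :: real assume "0 < \<epsilon>"
    then obtain n0 where n0: "2 * B n < \<epsilon>" if "n \<ge> n0" for n
      using order_tendstoD(2)[OF B0] by (auto simp: eventually_sequentially)
    have "d (x m) (x n) < \<epsilon>" if "n0 \<le> m" "n0 \<le> n" for m n
    proof (cases m n rule: linorder_cases)
      case less
      then show ?thesis using lt[of m n] n0[of m] that by simp
    next
      case equal
      then show ?thesis using self[of m] n0[of m] that by simp
    next
      case greater
      then show ?thesis
        using lt[of n m] n0[of n] that sym[OF xX xX, of m n] by simp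
    qed
    then show "\<exists>n0. \<forall>m\<ge>n0. \<forall>n\<ge>n0. d (x m) (x n) < \<epsilon>" by blast
  qed
qed

text \<open>The path from \<open>z\<close> to \<open>x n\<close> and back has length
  \<open>2 * d (x n) z\<close>, which tends to 0.\<close>

lemma self_distance_limit:
  assumes "d_converges x z"
  shows "d z z = 0"
proof -
  have x: "x n \<in> X" "z \<in> X" for n
    using assms by (auto simp: d_converges_def)
  have lim: "(\<lambda>n. d (x n) z) \<longlonglongrightarrow> 0"
    using assms by (auto simp: d_converges_def)
  have "d z z \<le> d (x n) z + d (x n) z" for n
    using triangle[OF x(2) x(2) x(1)[of n]] sym[OF x(2) x(1)[of n]] by simp
  moreover have "(\<lambda>n. d (x n) z + d (x n) z) \<longlonglongrightarrow> 0"
    using tendsto_add[OF lim lim] by simp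
  ultimately have "d z z \<le> 0" by (meson LIMSEQ_le_const)
  then show ?thesis using nonneg[OF x(2) x(2)] by simp
qed

end

lemma (in complete_dislocated_metric_space) class_A_d_fixed_point:
  assumes T: "T \<in> X \<rightarrow> X" and \<alpha>: "\<alpha> \<in> class_A_d"
    and contraction: "\<And>x y. \<lbrakk>x \<in> X; y \<in> X\<rbrakk> \<Longrightarrow> d (T x) (T y) \<le> \<alpha> (d x y) (d x (T x)) (d y (T y))"
  shows "\<exists>z\<in>X. T z = z \<and> (\<forall>w\<in>X. T w = w \<longrightarrow> w = z) \<and> d z z = 0"
proof -
  obtain k where k: "0 \<le> k" "k < 1"
    and A2: "\<And>a b. \<lbrakk>0 \<le> a; 0 \<le> b; a \<le> \<alpha> a b b \<or> a \<le> \<alpha> b a b \<or> a \<le> \<alpha> b b a\<rbrakk> \<Longrightarrow> a \<le> k * b"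
    using \<alpha> unfolding class_A_d_def mem_Collect_eq by metis
  have cont: "continuous_on ({0..} \<times> {0..} \<times> {0..}) (\<lambda>(a, b, c). \<alpha> a b c)"
    using \<alpha> unfolding class_A_d_def by auto
  have TX: "T x \<in> X" if "x \<in> X" for x using T that by auto
  obtain x0 where x0: "x0 \<in> X" using nonempty by auto
  define x where "x n = (T ^^ n) x0" for n
  have xS: "x (Suc n) = T (x n)" for n by (simp add: x_def)
  have xX: "x n \<in> X" for n by (induction n) (auto simp: x_def x0 TX)
  \<comment> \<open>At the points \<open>x n\<close> and \<open>x (Suc n)\<close> the contraction
    has the form a \<le> \<alpha>(b, b, a), the third alternative of (A2).\<close>
  have step: "d (x (Suc n)) (x (Suc (Suc n))) \<le> k * d (x n) (x (Suc n))" for n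
    using contraction[OF xX xX, of n "Suc n"] by (intro A2 nonneg xX) (simp add: xS)
  have decay: "d (x n) (x (Suc n)) \<le> k ^ n * d (x 0) (x (Suc 0))" for n
  proof (induction n)
    case (Suc n)
    then show ?case using step[of n] mult_left_mono[OF Suc k(1)] by (simp add: mult.assoc)
  qed simp
  have "d_Cauchy x"
    using xX decay by (intro d_Cauchy_geometric[OF _ k]) auto
  then obtain z where z: "z \<in> X" and conv: "d_converges x z"
    using complete unfolding d_complete_def by blast
  have lim: "(\<lambda>n. d (x n) z) \<longlonglongrightarrow> 0" using conv by (simp add: d_converges_def)
  have zz: "d z z = 0" by (rule self_distance_limit[OF conv])
  let ?r = "d z (T z)"
  have "(\<lambda>n. k ^ n * d (x 0) (x (Suc 0))) \<longlonglongrightarrow> 0"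
    by (intro tendsto_mult_left_zero LIMSEQ_realpow_zero k)
  then have lim_step: "(\<lambda>n. d (x n) (x (Suc n))) \<longlonglongrightarrow> 0"
    by (rule tendsto_sandwich[rotated 2, OF tendsto_const]) (auto simp: nonneg xX decay)
  have "(\<lambda>n. (d (x n) z, d (x n) (x (Suc n)), ?r)) \<longlonglongrightarrow> (0, 0, ?r)"
    by (intro tendsto_intros lim lim_step)
  then have "(\<lambda>n. (\<lambda>(a, b, c). \<alpha> a b c) (d (x n) z, d (x n) (x (Suc n)), ?r))
      \<longlonglongrightarrow> (\<lambda>(a, b, c). \<alpha> a b c) (0, 0, ?r)"
    by (rule continuous_on_tendsto_compose[OF cont]) (auto simp: nonneg xX z TX)
  then have "(\<lambda>n. d (x (Suc n)) z + \<alpha> (d (x n) z) (d (x n) (x (Suc n))) ?r) \<longlonglongrightarrow> 0 + \<alpha> 0 0 ?r"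
    by (intro tendsto_add LIMSEQ_Suc[OF lim]) simp
  \<comment> \<open>The triangle inequality passes through \<open>x (Suc n) = T (x n)\<close>, and
    the contraction at \<open>x n\<close> and \<open>z\<close> bounds the second leg.\<close>
  moreover have "?r \<le> d (x (Suc n)) z + \<alpha> (d (x n) z) (d (x n) (x (Suc n))) ?r" for n
    using triangle[OF z TX[OF z] xX[of "Suc n"]] sym[OF z xX[of "Suc n"]] contraction[OF xX[of n] z]
    by (simp add: xS)
  ultimately have "?r \<le> 0 + \<alpha> 0 0 ?r" by (meson LIMSEQ_le_const)
  then have "?r \<le> k * 0" by (intro A2 nonneg z TX) auto
  then have "?r = 0" using nonneg[OF z TX[OF z]] by simp
  then have Tz: "T z = z" using eq_if_zero[OF z TX[OF z]] by simp
  have "w = z" if w: "w \<in> X" "T w = w" for w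
  proof -
    \<comment> \<open>The self-distance of a fixed point has to be shown to vanish first: all three
      arguments of \<alpha> equal \<open>d w w\<close>, so (A2) applies with a = b.\<close>
    have "d w w \<le> k * d w w" using contraction[OF w(1) w(1)] w by (intro A2 nonneg) auto
    then have "(1 - k) * d w w \<le> 0" by (simp add: algebra_simps)
    then have ww: "d w w = 0" using k nonneg[OF w(1) w(1)] by (simp add: mult_le_0_iff)
    \<comment> \<open>With both self-distances zero the contraction reads a \<le> \<alpha>(a, 0, 0),
      the first alternative of (A2) with b = 0.\<close>
    have "d w z \<le> k * 0"
      using contraction[OF w(1) z] w z Tz ww zz by (intro A2 nonneg) auto
    then show ?thesis using nonneg[OF w(1) z] eq_if_zero[OF w(1) z] by simp
  qed
  then show ?thesis using z Tz zz by blast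
qed

text \<open>Subadditivity and monotonicity give the triangle inequality, positivity the separation
  of points. For completeness, a Cauchy sequence for the new distance is Cauchy for
  \<open>d\<close>, and continuity of \<Psi> at 0 carries its limit over.\<close>

lemma (in complete_dislocated_metric_space) complete_dislocated_metric_space_compose:
  fixes \<Psi> :: "real \<Rightarrow> real"
  assumes mono: "mono_on {0..} \<Psi>" and cont: "continuous_on {0..} \<Psi>"
    and zero: "\<Psi> 0 = 0" and pos: "\<And>s. 0 < s \<Longrightarrow> 0 < \<Psi> s"
    and sub: "subadditive_on_nonneg \<Psi>"
  shows "complete_dislocated_metric_space X (\<lambda>x y. \<Psi> (d x y))"
proof -
  have le: "\<Psi> s \<le> \<Psi> t" if "0 \<le> s" "s \<le> t" for s t
    using that by (intro mono_onD[OF mono]) auto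
  interpret \<Psi>: dislocated_metric_space X "\<lambda>x y. \<Psi> (d x y)"
  proof
    show "X \<noteq> {}" by (rule nonempty)
  next
    fix x y assume xy: "x \<in> X" "y \<in> X"
    show "0 \<le> \<Psi> (d x y)" using le[OF _ nonneg[OF xy]] zero by simp
    show "\<Psi> (d x y) = \<Psi> (d y x)" by (simp add: sym[OF xy])
    show "x = y" if "\<Psi> (d x y) = 0"
      using that pos[of "d x y"] nonneg[OF xy] eq_if_zero[OF xy] by fastforce
  next
    fix x y z assume X: "x \<in> X" "y \<in> X" "z \<in> X"
    have "\<Psi> (d x y) \<le> \<Psi> (d x z + d z y)" using X by (intro le nonneg triangle)
    also have "\<dots> \<le> \<Psi> (d x z) + \<Psi> (d z y)"
      using sub X nonneg unfolding subadditive_on_nonneg_def by blast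
    finally show "\<Psi> (d x y) \<le> \<Psi> (d x z) + \<Psi> (d z y)" .
  qed
  show ?thesis
  proof
    show \<Psi>.d_complete
      unfolding \<Psi>.d_complete_def
    proof (intro allI impI)
      fix x assume C: "\<Psi>.d_Cauchy x"
      then have xX: "x n \<in> X" for n by (auto simp: \<Psi>.d_Cauchy_def)
      have "d_Cauchy x"
        unfolding d_Cauchy_def
      proof (intro conjI allI impI)
        show "range x \<subseteq> X" using xX by auto
        fix \<epsilon> :: real assume \<epsilon>: "0 < \<epsilon>"
        \<comment> \<open>The threshold is \<Psi> \<epsilon>, positive by \<open>pos\<close>;
          monotonicity turns \<Psi> u < \<Psi> \<epsilon> into u < \<epsilon>.\<close>
        then obtain n0 where n0: "\<forall>m\<ge>n0. \<forall>n\<ge>n0. \<Psi> (d (x m) (x n)) < \<Psi> \<epsilon>"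
          using C pos unfolding \<Psi>.d_Cauchy_def by meson
        have "d (x m) (x n) < \<epsilon>" if "\<Psi> (d (x m) (x n)) < \<Psi> \<epsilon>" for m n
          using that le[of \<epsilon> "d (x m) (x n)"] \<epsilon> by linarith
        then show "\<exists>n0. \<forall>m\<ge>n0. \<forall>n\<ge>n0. d (x m) (x n) < \<epsilon>" using n0 by blast
      qed
      then obtain z where z: "z \<in> X" and "(\<lambda>n. d (x n) z) \<longlonglongrightarrow> 0"
        using complete unfolding d_complete_def d_converges_def by blast
      then have "(\<lambda>n. \<Psi> (d (x n) z)) \<longlonglongrightarrow> \<Psi> 0"
        by (intro continuous_on_tendsto_compose[OF cont]) (auto simp: nonneg xX)
      then show "\<exists>z\<in>X. \<Psi>.d_converges x z"
        using z xX zero unfolding \<Psi>.d_converges_def by auto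
    qed
  qed
qed

lemma class_Phi_set_integrable:
  assumes "\<phi> \<in> class_Phi"
  shows "set_integrable lebesgue {0..s} \<phi>"
  using assms by (auto simp: class_Phi_def)

lemma class_Phi_integral_mono:
  assumes "\<phi> \<in> class_Phi"
  shows "mono_on {0..} (\<lambda>s. LINT t:{0..s}|lebesgue. \<phi> t)"
proof (rule mono_onI)
  fix r s :: real assume "r \<le> s"
  then show "(LINT t:{0..r}|lebesgue. \<phi> t) \<le> (LINT t:{0..s}|lebesgue. \<phi> t)"
    using assms class_Phi_set_integrable[OF assms, of r] class_Phi_set_integrable[OF assms, of s]
    unfolding set_lebesgue_integral_def set_integrable_def
    by (intro integral_mono) (auto simp: class_Phi_def indicator_def)
qed

text \<open>On each compact interval this is the continuity of an indefinite integral, after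
  rewriting to the gauge integral; since continuity is local, the half-line follows.\<close>

lemma class_Phi_integral_continuous:
  assumes "\<phi> \<in> class_Phi"
  shows "continuous_on {0..} (\<lambda>s. LINT t:{0..s}|lebesgue. \<phi> t)"
proof -
  have eq: "(\<lambda>s. LINT t:{0..s}|lebesgue. \<phi> t) = (\<lambda>s. integral {0..s} \<phi>)"
    using set_lebesgue_integral_eq_integral(2)[OF class_Phi_set_integrable[OF assms]] by blast
  have on: "continuous_on {0..b} (\<lambda>s. integral {0..s} \<phi>)" for b :: real
    using set_lebesgue_integral_eq_integral(1)[OF class_Phi_set_integrable[OF assms]]
    by (rule indefinite_integral_continuous_1)
  show ?thesis
    unfolding eq continuous_on_eq_continuous_within
  proof
    fix s :: real assume "s \<in> {0..}"
    then have "continuous (at s within {0..s + 1}) (\<lambda>s. integral {0..s} \<phi>)"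
      using on[of "s + 1"] by (simp add: continuous_on_eq_continuous_within)
    \<comment> \<open>The right end \<open>s + 1\<close> lies strictly beyond \<open>s\<close>, so
      both sets coincide near \<open>s\<close>.\<close>
    moreover have "at s within {0..s + 1} = at s within {0..}"
      by (rule at_within_nhd[of s "{..<s + 1}"]) auto
    ultimately show "continuous (at s within {0..}) (\<lambda>s. integral {0..s} \<phi>)" by simp
  qed
qed

theorem theorem3p9:
  fixes X :: "'a set" and d :: "'a \<Rightarrow> 'a \<Rightarrow> real" and T :: "'a \<Rightarrow> 'a"
    and \<alpha> :: "real \<Rightarrow> real \<Rightarrow> real \<Rightarrow> real" and \<phi> :: "real \<Rightarrow> real"
  assumes "complete_dislocated_metric_space X d"
    and "T \<in> X \<rightarrow> X"
    and "\<alpha> \<in> class_A_d"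
    and "\<phi> \<in> class_Phi"
    and "subadditive_on_nonneg (\<lambda>s. LINT t:{0..s}|lebesgue. \<phi> t)"
    and "\<And>x y. \<lbrakk>x \<in> X; y \<in> X\<rbrakk> \<Longrightarrow>
      (LINT t:{0..d (T x) (T y)}|lebesgue. \<phi> t)
        \<le> \<alpha> (LINT t:{0..d x y}|lebesgue. \<phi> t)
            (LINT t:{0..d x (T x)}|lebesgue. \<phi> t)
            (LINT t:{0..d y (T y)}|lebesgue. \<phi> t)"
  shows "\<exists>z\<in>X. T z = z \<and> (\<forall>w\<in>X. T w = w \<longrightarrow> w = z) \<and> d z z = 0"
proof -
  let ?\<Psi> = "\<lambda>s. LINT t:{0..s}|lebesgue. \<phi> t"
  interpret complete_dislocated_metric_space X d by (rule assms(1))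
  have zero: "?\<Psi> 0 = 0"
    using set_lebesgue_integral_eq_integral(2)[OF class_Phi_set_integrable[OF assms(4)], of 0]
    by simp
  have pos: "0 < ?\<Psi> s" if "0 < s" for s
    using assms(4) that by (simp add: class_Phi_def)
  interpret \<Psi>: complete_dislocated_metric_space X "\<lambda>x y. ?\<Psi> (d x y)"
    using class_Phi_integral_mono[OF assms(4)] class_Phi_integral_continuous[OF assms(4)]
      zero pos assms(5)
    by (rule complete_dislocated_metric_space_compose)
  \<comment> \<open>Being a fixed point does not depend on the distance, so only the self-distance
    must be carried back from \<Psi> \<circ> d to d, which \<open>pos\<close> does.\<close>
  obtain z where z: "z \<in> X" "T z = z" "\<forall>w\<in>X. T w = w \<longrightarrow> w = z" "?\<Psi> (d z z) = 0"
    using \<Psi>.class_A_d_fixed_point[OF assms(2,3,6)] by blast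
  then have "d z z = 0" using pos[of "d z z"] nonneg[of z z] by fastforce
  then show ?thesis using z by blast
qed

end
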